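(* Let $m\ge 1$ be an integer and let $E=X\oplus Y$ be a Banach space, where $X,Y$ are closed subspaces with $X$ isomorphic to $Y$, and suppose $X$ is isomorphic to its closed subspaces of codimension $m$ (in $X$). Let $P$ be the projector onto $X$ along $Y$. Then there exists a projector $Q\in\mathcal{P}(E)$, connected to $P$ by a continuous path in $\mathcal{P}(E)$, such that $Q-P$ is compact and $\dim(\operatorname{Range}Q,\operatorname{Range}P)=m$.
   Context: $\mathcal{P}(E)$ is the space of bounded operators $P$ on $E$ with $P^2=P$ (projectors), with the norm topology. "Isomorphic" means linearly homeomorphic. Relative dimension: two closed complemented subspaces $V,W\subset E$ are compact perturbation of each other if, for projectors $P_V,P_W$ with ranges $V,W$, the operators $(I-P_V)P_W$ and $(I-P_W)P_V$ are compact (independent of the choice of projectors). Then $P_W|_V\colon V\to W$ is Fredholm and $\dim(V,W):=\operatorname{ind}(P_W|_V\colon V\to W)$, independent of the choice of projectors. If $Q-P$ is compact, then $\operatorname{Range}Q$ and $\operatorname{Range}P$ are compact perturbation of each other. *)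

theory Defs
  imports "HOL-Analysis.Analysis"
begin

definition projectors :: "('a::real_normed_vector \<Rightarrow>\<^sub>L 'a) set" where
  "projectors = {P. P o\<^sub>L P = P}"

definition compact_operator ::
    "('a::real_normed_vector \<Rightarrow>\<^sub>L 'b::real_normed_vector) \<Rightarrow> bool" where
  "compact_operator T \<longleftrightarrow> compact (closure (blinfun_apply T ` cball 0 1))"

definition finite_dimensional :: "'a::real_vector set \<Rightarrow> bool" where
  "finite_dimensional V \<longleftrightarrow> (\<exists>B. finite B \<and> span B = V)"

(* The quotient W/U has finite dimension n. An algebraic complement of U in W is
   mapped isomorphically onto W/U by the quotient map, so W/U is represented by such
   a complement C. The predicate also entails that U is contained in W. *)
definition has_codim :: "'a::real_vector set \<Rightarrow> 'a set \<Rightarrow> nat \<Rightarrow> bool" where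
  "has_codim U W n \<longleftrightarrow>
     (\<exists>C. subspace C \<and> finite_dimensional C \<and> dim C = n \<and>
          U \<inter> C = {0} \<and> {u + c | u c. u \<in> U \<and> c \<in> C} = W)"

definition isomorphic_subspaces ::
    "'a::real_normed_vector set \<Rightarrow> 'b::real_normed_vector set \<Rightarrow> bool" where
  "isomorphic_subspaces V W \<longleftrightarrow>
     (\<exists>f g. homeomorphism V W f g \<and>
            (\<forall>x\<in>V. \<forall>y\<in>V. f (x + y) = f x + f y) \<and>
            (\<forall>c. \<forall>x\<in>V. f (c *\<^sub>R x) = c *\<^sub>R f x))"

(* In the next two definitions T is applied to elements of V only: they speak about
   the restriction of T to a map from V to W. *)
definition fredholm_between ::
    "('a::real_normed_vector \<Rightarrow>\<^sub>L 'b::real_normed_vector) \<Rightarrow> 'a set \<Rightarrow> 'b set \<Rightarrow> bool" where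
  "fredholm_between T V W \<longleftrightarrow>
     finite_dimensional {x \<in> V. blinfun_apply T x = 0} \<and>
     closed (blinfun_apply T ` V) \<and>
     (\<exists>n. has_codim (blinfun_apply T ` V) W n)"

definition fredholm_index ::
    "('a::real_normed_vector \<Rightarrow>\<^sub>L 'b::real_normed_vector) \<Rightarrow> 'a set \<Rightarrow> 'b set \<Rightarrow> int" where
  "fredholm_index T V W =
     (if fredholm_between T V W
      then int (dim {x \<in> V. blinfun_apply T x = 0})
           - int (THE n. has_codim (blinfun_apply T ` V) W n)
      else undefined)"

definition projector_onto ::
    "('a::real_normed_vector \<Rightarrow>\<^sub>L 'a) \<Rightarrow> 'a set \<Rightarrow> bool" where
  "projector_onto P V \<longleftrightarrow> P \<in> projectors \<and> range (blinfun_apply P) = V"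

(* The existence of the projectors expresses that V and W are closed and complemented;
   the compactness conditions do not depend on which projectors are taken. *)
definition compact_perturbation :: "'a::real_normed_vector set \<Rightarrow> 'a set \<Rightarrow> bool" where
  "compact_perturbation V W \<longleftrightarrow>
     (\<exists>PV PW. projector_onto PV V \<and> projector_onto PW W \<and>
        compact_operator ((id_blinfun - PV) o\<^sub>L PW) \<and>
        compact_operator ((id_blinfun - PW) o\<^sub>L PV))"

(* The relative dimension dim(V,W), left unspecified unless V and W are compact
   perturbation of each other. The index does not depend on the projector chosen. *)
definition relative_dim :: "'a::real_normed_vector set \<Rightarrow> 'a set \<Rightarrow> int" where
  "relative_dim V W =
     (if compact_perturbation V W
      then fredholm_index (SOME PW. projector_onto PW W) V W
      else undefined)"

end

theory Submission
  imports Defs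
begin

text \<open>
  Call two projectors equivalent if there are bounded operators between their ranges that are
  inverse to each other (the Murray--von Neumann relation). The proof rests on one fact: two
  equivalent projectors \<open>A\<close>, \<open>B\<close> with \<open>AB = BA = 0\<close> are joined by a path of projectors, because
  the range of \<open>A\<close> can be rotated onto the range of \<open>B\<close> inside the sum of the two ranges
  (\<open>orthogonal_projector_equiv_path_component\<close>).

  Split \<open>X = X' \<oplus> C\<close> with \<open>X'\<close> closed and \<open>dim C = m\<close>, and carry this splitting over to
  \<open>Y = Y' \<oplus> F\<close> by the isomorphism of \<open>X\<close> with \<open>Y\<close>. Let \<open>Q\<close> be the projector onto \<open>X \<oplus> F\<close> along
  \<open>Y'\<close> and \<open>D = I - Q\<close>. Two rotations lead from \<open>P\<close> to \<open>Q\<close>: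
  \<^item> \<open>P\<close> is equivalent to \<open>D\<close>, since \<open>X\<close>, \<open>X'\<close> and \<open>Y'\<close> are isomorphic, and \<open>P\<close> and \<open>D\<close> annihilate
    each other. The first rotation keeps \<open>F\<close> in the kernel.
  \<^item> \<open>Q\<close> is equivalent to \<open>P\<close>, since \<open>X \<oplus> F\<close> is isomorphic to \<open>X' \<oplus> C = X\<close>. Hence \<open>D\<close> and \<open>Q\<close> are
    equivalent, and they are complementary.

  The difference \<open>R = Q - P\<close> is a projector onto the \<open>m\<close>-dimensional space \<open>F\<close>, hence compact,
  and projecting \<open>X \<oplus> F\<close> to \<open>X\<close> is surjective with a kernel of dimension \<open>m\<close>
  (\<open>relative_dim_add_finite_rank\<close>).

  The analytic input is that a finite-dimensional algebraic complement of a closed subspace is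
  automatically a topological one (\<open>finite_dim_component_bounded\<close>), so that the
  projector onto \<open>C\<close> along \<open>X'\<close> is bounded.
\<close>

section \<open>Finite-dimensional subspaces of normed spaces\<close>

lemma projectors_apply:
  "A \<in> projectors \<longleftrightarrow> (\<forall>x. blinfun_apply A (blinfun_apply A x) = blinfun_apply A x)"
  unfolding projectors_def
  by (auto intro!: blinfun_eqI dest: arg_cong[where f = blinfun_apply]
      simp: fun_eq_iff simp flip: blinfun_apply_blinfun_compose)

text \<open>
  The vector \<open>b\<close> has positive distance from the closed span of \<open>U\<close>, and this distance is at most
  \<open>norm x / \<bar>k\<bar>\<close> because \<open>b - x / k\<close> lies in the span.
\<close>

lemma coefficient_bounded:
  fixes U :: "'a::real_normed_vector set"
  assumes "closed (span U)" "b \<notin> span U"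
  obtains K where "K > 0" "\<And>x k. x - k *\<^sub>R b \<in> span U \<Longrightarrow> \<bar>k\<bar> \<le> K * norm x"
proof -
  define d where "d = infdist b (span U)"
  have d: "d > 0"
    unfolding d_def using assms span_zero by (intro infdist_pos_not_in_closed) blast+
  have "\<bar>k\<bar> \<le> inverse d * norm x" if x: "x - k *\<^sub>R b \<in> span U" for x k
  proof (cases "k = 0")
    case False
    have "- (inverse k *\<^sub>R (x - k *\<^sub>R b)) \<in> span U"
      using x by (metis span_neg span_scale)
    also have "- (inverse k *\<^sub>R (x - k *\<^sub>R b)) = b - inverse k *\<^sub>R x"
      using False by (simp add: algebra_simps)
    finally have "d \<le> dist b (b - inverse k *\<^sub>R x)"
      unfolding d_def by (rule infdist_le)
    also have "\<dots> = norm x / \<bar>k\<bar>"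
      by (simp add: dist_norm divide_inverse)
    finally show ?thesis using d False by (simp add: field_simps)
  qed (use d in auto)
  then show ?thesis using d by (intro that[of "inverse d"]) auto
qed

text \<open>
  Along a convergent sequence the coefficients of \<open>b\<close> form a Cauchy sequence of reals, by the
  previous bound. Subtracting the limit multiple of \<open>b\<close> leaves a limit of vectors of the closed
  span of \<open>U\<close>.
\<close>

lemma closed_span_insert:
  fixes U :: "'a::real_normed_vector set"
  assumes "closed (span U)"
  shows "closed (span (insert b U))"
proof (cases "b \<in> span U")
  case True
  then show ?thesis using assms by (simp add: span_redundant)
next
  case False
  then obtain K where K: "K > 0" "\<And>x k. x - k *\<^sub>R b \<in> span U \<Longrightarrow> \<bar>k\<bar> \<le> K * norm x"
    using coefficient_bounded assms by blast
  show ?thesis unfolding closed_sequential_limits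
  proof (intro allI impI, elim conjE)
    fix x l assume x: "\<forall>n. x n \<in> span (insert b U)" and l: "x \<longlonglongrightarrow> l"
    have "\<forall>n. \<exists>k. x n - k *\<^sub>R b \<in> span U"
      using x by (simp add: span_insert)
    then obtain k where k: "\<And>n. x n - k n *\<^sub>R b \<in> span U" by metis
    have le: "\<bar>k i - k j\<bar> \<le> K * dist (x i) (x j)" for i j
    proof -
      have "(x i - k i *\<^sub>R b) - (x j - k j *\<^sub>R b) \<in> span U"
        by (rule span_diff[OF k k])
      then have "(x i - x j) - (k i - k j) *\<^sub>R b \<in> span U"
        by (simp add: algebra_simps)
      from K(2)[OF this] show ?thesis by (simp add: dist_norm)
    qed
    have "Cauchy k"
    proof (rule metric_CauchyI)
      fix e :: real assume "e > 0"
      then have "e / K > 0" using K by simp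
      then obtain N where N: "\<forall>i\<ge>N. \<forall>j\<ge>N. dist (x i) (x j) < e / K"
        using LIMSEQ_imp_Cauchy[OF l] unfolding Cauchy_def by blast
      then have "\<forall>i\<ge>N. \<forall>j\<ge>N. K * dist (x i) (x j) < e"
        using K by (simp add: field_simps)
      then show "\<exists>N. \<forall>i\<ge>N. \<forall>j\<ge>N. dist (k i) (k j) < e"
        using le by (metis dist_real_def order_le_less_trans)
    qed
    then obtain t where t: "k \<longlonglongrightarrow> t" using Cauchy_convergent convergentD by blast
    have "(\<lambda>n. x n - k n *\<^sub>R b) \<longlonglongrightarrow> l - t *\<^sub>R b"
      by (intro tendsto_intros l t)
    with assms k have "l - t *\<^sub>R b \<in> span U"
      by (rule closed_sequentially)
    then show "l \<in> span (insert b U)" by (auto simp: span_insert)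
  qed
qed

lemma closed_span_Un_finite:
  fixes U :: "'a::real_normed_vector set"
  assumes "finite B" "closed (span U)"
  shows "closed (span (B \<union> U))"
  using assms by (induction B rule: finite_induct) (auto intro: closed_span_insert)

lemma compact_closed_subset:
  fixes S W :: "'a::t2_space set"
  assumes "compact S" "closed W" "W \<subseteq> S"
  shows "compact W"
  using compact_Int_closed[OF assms(1,2)] assms(3) by (simp add: inf.absorb2)

text \<open>
  The projection of \<open>span U \<oplus> span B\<close> onto its finite-dimensional summand is bounded. The induction
  splits off one vector \<open>b\<close> at a time: its coefficient is controlled because \<open>b\<close> lies outside the
  closed subspace \<open>span (B \<union> U)\<close>.
\<close>

lemma finite_dim_component_bounded:
  fixes U :: "'a::real_normed_vector set"
  assumes "finite B" "closed (span U)" "span B \<inter> span U = {0}"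
  shows "\<exists>K. \<forall>u\<in>span U. \<forall>c\<in>span B. norm c \<le> K * norm (u + c)"
  using assms
proof (induction B rule: finite_induct)
  case empty
  then show ?case by (intro exI[of _ 0]) auto
next
  case (insert b B)
  have "span B \<subseteq> span (insert b B)" by (intro span_mono) auto
  then have "span B \<inter> span U = {0}"
    using insert.prems(2) span_zero[of B] span_zero[of U] by blast
  then obtain K where K: "\<forall>u\<in>span U. \<forall>c\<in>span B. norm c \<le> K * norm (u + c)"
    using insert by blast
  show ?case
  proof (cases "b \<in> span B")
    case True
    then show ?thesis using K by (auto simp: span_redundant)
  next
    case False
    have "b \<notin> span (B \<union> U)"
    proof
      assume "b \<in> span (B \<union> U)"
      then obtain c u where cu: "c \<in> span B" "u \<in> span U" "b = c + u"
        by (auto simp: span_Un)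
      have "u = b - c" using cu by simp
      moreover have "b - c \<in> span (insert b B)"
        using cu(1) \<open>span B \<subseteq> _\<close> by (intro span_diff) (auto intro: span_base)
      ultimately have "u \<in> span (insert b B)" by simp
      then have "u = 0" using insert.prems(2) cu(2) by blast
      then show False using False cu by simp
    qed
    then obtain L where L: "L > 0" "\<And>x k. x - k *\<^sub>R b \<in> span (B \<union> U) \<Longrightarrow> \<bar>k\<bar> \<le> L * norm x"
      using coefficient_bounded[OF closed_span_Un_finite[OF insert.hyps(1) insert.prems(1)]] by blast
    have "norm c \<le> (\<bar>K\<bar> * (1 + L * norm b) + L * norm b) * norm (u + c)"
      if "u \<in> span U" "c \<in> span (insert b B)" for u c
    proof -
      obtain k where k: "c - k *\<^sub>R b \<in> span B" using \<open>c \<in> _\<close> by (auto simp: span_insert)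
      let ?c = "c - k *\<^sub>R b"
      have "u + ?c \<in> span (B \<union> U)"
        using that(1) k span_mono[of U "B \<union> U"] span_mono[of B "B \<union> U"]
        by (intro span_add) auto
      then have "\<bar>k\<bar> \<le> L * norm (u + c)" by (intro L) (simp add: algebra_simps)
      then have kb: "\<bar>k\<bar> * norm b \<le> L * norm (u + c) * norm b"
        by (intro mult_right_mono) auto
      have "norm ?c \<le> K * norm (u + ?c)" using K that k by blast
      also have "\<dots> \<le> \<bar>K\<bar> * norm (u + ?c)" by (intro mult_right_mono) auto
      also have "\<dots> \<le> \<bar>K\<bar> * (norm (u + c) + \<bar>k\<bar> * norm b)"
        using norm_triangle_ineq4[of "u + c" "k *\<^sub>R b"]
        by (intro mult_left_mono) (auto simp: algebra_simps)
      also have "\<dots> \<le> \<bar>K\<bar> * (norm (u + c) + L * norm (u + c) * norm b)"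
        using kb by (intro mult_left_mono) auto
      finally have "norm ?c \<le> \<bar>K\<bar> * (norm (u + c) + L * norm (u + c) * norm b)" .
      moreover have "norm c \<le> norm ?c + \<bar>k\<bar> * norm b"
        using norm_triangle_ineq[of ?c "k *\<^sub>R b"] by simp
      ultimately show ?thesis using kb by (simp add: algebra_simps)
    qed
    then show ?thesis by blast
  qed
qed

text \<open>
  By induction on \<open>B\<close>, a ball of \<open>span (insert b B)\<close> is a closed part of the sum of a larger ball of
  \<open>span B\<close> and a compact segment in the direction of \<open>b\<close>.
\<close>

lemma compact_cball_Int_span_finite:
  fixes B :: "'a::real_normed_vector set"
  assumes "finite B"
  shows "compact (cball 0 r \<inter> span B)"
  using assms
proof (induction B arbitrary: r rule: finite_induct)
  case empty
  then show ?case by (auto intro: finite_imp_compact)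
next
  case (insert b B)
  have cl: "closed (span B)" using closed_span_Un_finite[of B "{}"] insert by simp
  show ?case
  proof (cases "b \<in> span B")
    case True
    then show ?thesis using insert by (simp add: span_redundant)
  next
    case False
    then obtain L where L: "L > 0" "\<And>x k. x - k *\<^sub>R b \<in> span B \<Longrightarrow> \<bar>k\<bar> \<le> L * norm x"
      using coefficient_bounded cl by metis
    define S where "S = {c + y | c y. c \<in> cball 0 (r + L * r * norm b) \<inter> span B \<and>
                           y \<in> (\<lambda>k. k *\<^sub>R b) ` {- L * r..L * r}}"
    have "compact S"
      unfolding S_def using insert.IH
      by (intro compact_sums compact_continuous_image continuous_intros compact_Icc)
    moreover have "cball 0 r \<inter> span (insert b B) \<subseteq> S"
    proof
      fix x assume x: "x \<in> cball 0 r \<inter> span (insert b B)"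
      then obtain k where k: "x - k *\<^sub>R b \<in> span B" by (auto simp: span_insert)
      have "\<bar>k\<bar> \<le> L * norm x" using L k by blast
      also have "\<dots> \<le> L * r" using x L by (intro mult_left_mono) auto
      finally have kr: "\<bar>k\<bar> \<le> L * r" .
      have "norm (x - k *\<^sub>R b) \<le> norm x + \<bar>k\<bar> * norm b"
        using norm_triangle_ineq4[of x "k *\<^sub>R b"] by simp
      also have "\<dots> \<le> r + L * r * norm b"
        using x kr by (intro add_mono mult_right_mono) auto
      finally have "x - k *\<^sub>R b \<in> cball 0 (r + L * r * norm b) \<inter> span B" using k by simp
      moreover have "k *\<^sub>R b \<in> (\<lambda>k. k *\<^sub>R b) ` {- L * r..L * r}"
        using kr by (intro imageI) (simp add: abs_le_iff)
      moreover have "x = (x - k *\<^sub>R b) + k *\<^sub>R b" by simp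
      ultimately show "x \<in> S" unfolding S_def by blast
    qed
    moreover have "closed (cball 0 r \<inter> span (insert b B))"
      using closed_span_insert[OF cl] by (intro closed_Int) auto
    ultimately show ?thesis using compact_closed_subset by blast
  qed
qed

lemma finite_rank_compact:
  assumes "finite B" "range (blinfun_apply T) \<subseteq> span B"
  shows "compact_operator T"
proof -
  have "blinfun_apply T ` cball 0 1 \<subseteq> cball 0 (norm T) \<inter> span B"
  proof
    fix y assume "y \<in> blinfun_apply T ` cball 0 1"
    then obtain x where x: "y = T x" "norm x \<le> 1" by auto
    have "norm (T x) \<le> norm T * norm x" by (rule norm_blinfun)
    also have "\<dots> \<le> norm T" using x by (simp add: mult_left_le)
    finally show "y \<in> cball 0 (norm T) \<inter> span B" using x assms by auto
  qed
  moreover have "compact (cball 0 (norm T) \<inter> span B)"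
    using assms(1) by (rule compact_cball_Int_span_finite)
  ultimately show ?thesis
    unfolding compact_operator_def
    by (meson closed_closure closure_minimal compact_closed_subset compact_imp_closed)
qed

lemma isCont_linear_imp_bounded_linear:
  fixes f :: "'a::real_normed_vector \<Rightarrow> 'b::real_normed_vector"
  assumes "linear f" "isCont f 0"
  shows "bounded_linear f"
proof -
  have f0: "f 0 = 0" using assms(1) by (rule linear_0)
  obtain d where d: "d > 0" "\<And>x. norm x < d \<Longrightarrow> norm (f x) < 1"
    using assms(2) unfolding continuous_at_eps_delta f0 dist_norm by (metis diff_zero zero_less_one)
  have "norm (f x) \<le> norm x * (2 / d)" for x
  proof (cases "x = 0")
    case False
    let ?k = "d / (2 * norm x)"
    have "?k * norm (f x) = norm (f (?k *\<^sub>R x))"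
      using d by (simp add: linear_scale[OF assms(1)])
    also have "\<dots> < 1" using d False by (intro d(2)) simp
    finally show ?thesis using d False by (simp add: field_simps)
  qed (simp add: f0)
  then show ?thesis using assms(1)
    by (intro bounded_linear_intro[where K = "2 / d"]) (auto simp: linear_add linear_scale)
qed

section \<open>Equivalence of projectors\<close>

text \<open>
  The Murray--von Neumann equivalence. The last four equations normalise the
  pair: \<open>S\<close> vanishes on the kernel of \<open>A\<close> and maps into the range of \<open>B\<close>, and \<open>T\<close> likewise with
  \<open>A\<close> and \<open>B\<close> exchanged. They make all identities below provable by rewriting.
\<close>

definition projector_equiv ::
    "('a::real_normed_vector \<Rightarrow>\<^sub>L 'a) \<Rightarrow> ('a \<Rightarrow>\<^sub>L 'a) \<Rightarrow> bool" where
  "projector_equiv A B \<longleftrightarrow>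
     (\<exists>(S :: 'a \<Rightarrow>\<^sub>L 'a) (T :: 'a \<Rightarrow>\<^sub>L 'a). \<forall>x. T (S x) = A x \<and> S (T x) = B x \<and>
        S (A x) = S x \<and> B (S x) = S x \<and> T (B x) = T x \<and> A (T x) = T x)"

lemma projector_equiv_sym: "projector_equiv A B \<Longrightarrow> projector_equiv B A"
  unfolding projector_equiv_def by blast

lemma projector_equiv_trans:
  assumes "projector_equiv A B" "projector_equiv B C"
  shows "projector_equiv A C"
proof -
  obtain S T S' T' :: "'a \<Rightarrow>\<^sub>L 'a"
    where "\<And>x. T (S x) = A x" "\<And>x. S (T x) = B x" "\<And>x. S (A x) = S x"
      "\<And>x. B (S x) = S x" "\<And>x. T (B x) = T x" "\<And>x. A (T x) = T x"
      and "\<And>x. T' (S' x) = B x" "\<And>x. S' (T' x) = C x" "\<And>x. S' (B x) = S' x"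
      "\<And>x. C (S' x) = S' x" "\<And>x. T' (C x) = T' x" "\<And>x. B (T' x) = T' x"
    using assms unfolding projector_equiv_def by metis
  then show ?thesis
    unfolding projector_equiv_def
    by (intro exI[of _ "S' o\<^sub>L S"] exI[of _ "T o\<^sub>L T'"]) simp
qed

lemma projector_equiv_add:
  assumes "projector_equiv A A'" "projector_equiv B B'"
    and "\<And>x. A (B x) = 0" "\<And>x. B (A x) = 0" "\<And>x. A' (B' x) = 0" "\<And>x. B' (A' x) = 0"
  shows "projector_equiv (A + B) (A' + B')"
proof -
  obtain S T :: "'a \<Rightarrow>\<^sub>L 'a"
    where 1: "\<And>x. T (S x) = A x" "\<And>x. S (T x) = A' x" "\<And>x. S (A x) = S x"
      "\<And>x. A' (S x) = S x" "\<And>x. T (A' x) = T x" "\<And>x. A (T x) = T x"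
    using assms(1) unfolding projector_equiv_def by blast
  obtain S' T' :: "'a \<Rightarrow>\<^sub>L 'a"
    where 2: "\<And>x. T' (S' x) = B x" "\<And>x. S' (T' x) = B' x" "\<And>x. S' (B x) = S' x"
      "\<And>x. B' (S' x) = S' x" "\<And>x. T' (B' x) = T' x" "\<And>x. B (T' x) = T' x"
    using assms(2) unfolding projector_equiv_def by blast
  have "T (S' x) = 0" "T' (S x) = 0" "S (T' x) = 0" "S' (T x) = 0"
    "S (B x) = 0" "S' (A x) = 0" "T (B' x) = 0" "T' (A' x) = 0"
    "A (T' x) = 0" "B (T x) = 0" "A' (S' x) = 0" "B' (S x) = 0" for x
    using assms(3-6) 1 2 by (metis blinfun.zero_right)+
  with 1 2 show ?thesis
    unfolding projector_equiv_def
    by (intro exI[of _ "S + S'"] exI[of _ "T + T'"]) (simp add: blinfun.bilinear_simps)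
qed

text \<open>
  The witnesses of an equivalence from \<open>A\<close> to another projector also transport every
  subprojector \<open>A'\<close> of \<open>A\<close>.
\<close>

lemma projector_equiv_transport:
  fixes S T A A' :: "'a::real_normed_vector \<Rightarrow>\<^sub>L 'a"
  assumes "\<And>x. T (S x) = A x"
    and "\<And>x. A (A' x) = A' x" "\<And>x. A' (A x) = A' x" "\<And>x. A' (A' x) = A' x"
  shows "projector_equiv A' (S o\<^sub>L A' o\<^sub>L T)"
  unfolding projector_equiv_def using assms
  by (intro exI[of _ "S o\<^sub>L A'"] exI[of _ "A' o\<^sub>L T"]) simp

text \<open>
  An isomorphism of the ranges is defined on a subspace only. Precomposition with the projector
  extends it to a bounded operator on the whole space.
\<close>

lemma isomorphic_ranges_imp_projector_equiv:
  assumes "A \<in> projectors" "B \<in> projectors"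
    and "isomorphic_subspaces (range (blinfun_apply A)) (range (blinfun_apply B))"
  shows "projector_equiv A B"
proof -
  obtain f g where fg: "homeomorphism (range A) (range B) f g"
    and add: "\<And>u v. u \<in> range A \<Longrightarrow> v \<in> range A \<Longrightarrow> f (u + v) = f u + f v"
    and scale: "\<And>c u. u \<in> range A \<Longrightarrow> f (c *\<^sub>R u) = c *\<^sub>R f u"
    using assms(3) unfolding isomorphic_subspaces_def by blast
  have AA: "A (A x) = A x" and BB: "B (B x) = B x" for x
    using assms(1,2) by (auto simp: projectors_apply)
  have gf: "g (f (A x)) = A x" and fg': "f (g (B x)) = B x" for x
    using homeomorphism_apply1[OF fg] homeomorphism_apply2[OF fg] by auto
  have fB: "B (f (A x)) = f (A x)" for x
    using homeomorphism_image1[OF fg] BB by (metis image_eqI rangeE rangeI)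
  have gA: "A (g (B x)) = g (B x)" for x
    using homeomorphism_image2[OF fg] AA by (metis image_eqI rangeE rangeI)
  have g_add: "g (B x + B y) = g (B x) + g (B y)" for x y
  proof -
    have "B x + B y = f (g (B x) + g (B y))"
      using add[of "g (B x)" "g (B y)"] gA fg' by (metis rangeI)
    moreover have "g (B x) + g (B y) = A (g (B x) + g (B y))"
      by (simp add: blinfun.add_right gA)
    ultimately show ?thesis by (metis gf)
  qed
  have g_scale: "g (c *\<^sub>R B x) = c *\<^sub>R g (B x)" for c x
  proof -
    have "c *\<^sub>R B x = f (c *\<^sub>R g (B x))"
      using scale[of "g (B x)" c] gA fg' by (metis rangeI)
    moreover have "c *\<^sub>R g (B x) = A (c *\<^sub>R g (B x))"
      by (simp add: blinfun.scaleR_right gA)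
    ultimately show ?thesis by (metis gf)
  qed
  have "continuous_on UNIV (\<lambda>x. f (A x))"
    by (rule continuous_on_compose2[OF homeomorphism_cont1[OF fg]]) (auto intro!: continuous_intros)
  then have "bounded_linear (\<lambda>x. f (A x))"
    by (intro isCont_linear_imp_bounded_linear linearI)
       (auto simp: blinfun.add_right blinfun.scaleR_right add scale continuous_on_eq_continuous_at)
  then obtain S where S: "\<And>x. blinfun_apply S x = f (A x)"
    by (metis bounded_linear_Blinfun_apply)
  have "continuous_on UNIV (\<lambda>x. g (B x))"
    by (rule continuous_on_compose2[OF homeomorphism_cont2[OF fg]]) (auto intro!: continuous_intros)
  then have "bounded_linear (\<lambda>x. g (B x))"
    by (intro isCont_linear_imp_bounded_linear linearI)
       (auto simp: blinfun.add_right blinfun.scaleR_right g_add g_scale continuous_on_eq_continuous_at)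
  then obtain T where T: "\<And>x. blinfun_apply T x = g (B x)"
    by (metis bounded_linear_Blinfun_apply)
  show ?thesis
    unfolding projector_equiv_def
    by (intro exI[of _ S] exI[of _ T]) (simp add: S T fB gA gf fg' AA BB)
qed

text \<open>
  On the sum of the two ranges, \<open>S\<close> and \<open>T\<close> identify \<open>A\<close> and \<open>B\<close> with the matrix units
  \<open>e\<^sub>1\<^sub>1\<close> and \<open>e\<^sub>2\<^sub>2\<close>, and \<open>S\<close>, \<open>T\<close> themselves with \<open>e\<^sub>2\<^sub>1\<close>, \<open>e\<^sub>1\<^sub>2\<close>. For \<open>c\<^sup>2 + s\<^sup>2 = 1\<close>, the matrix with
  rows \<open>(c\<^sup>2, cs)\<close> and \<open>(cs, s\<^sup>2)\<close> is the orthogonal projection onto the line through \<open>(c, s)\<close>.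
  Turning this line by a right angle gives the path.
\<close>

lemma orthogonal_projector_equiv_path_component:
  fixes A B :: "'a::real_normed_vector \<Rightarrow>\<^sub>L 'a"
  assumes "projector_equiv A B" "\<And>x. A (B x) = 0" "\<And>x. B (A x) = 0"
  shows "path_component projectors A B"
proof -
  obtain S T :: "'a \<Rightarrow>\<^sub>L 'a"
    where ST: "\<And>x. T (S x) = A x" "\<And>x. S (T x) = B x" "\<And>x. S (A x) = S x"
      "\<And>x. B (S x) = S x" "\<And>x. T (B x) = T x" "\<And>x. A (T x) = T x"
    using assms(1) unfolding projector_equiv_def by blast
  have AB: "A (A x) = A x" "B (B x) = B x" for x
    by (metis ST)+
  have 0: "A (S x) = 0" "B (T x) = 0" "S (S x) = 0" "T (T x) = 0" "S (B x) = 0" "T (A x) = 0" for x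
    using assms(2,3) ST by (metis blinfun.zero_right)+
  define G where "G = (\<lambda>c s. (c * c) *\<^sub>R A + (s * s) *\<^sub>R B + (c * s) *\<^sub>R (S + T))"
  have G: "G c s \<in> projectors" if "c * c + s * s = 1" for c s :: real
    unfolding projectors_apply
  proof
    fix x
    have "G c s (G c s x) = (c * c * (c * c + s * s)) *\<^sub>R A x + (s * s * (c * c + s * s)) *\<^sub>R B x
        + (c * s * (c * c + s * s)) *\<^sub>R (S x + T x)"
      by (simp add: G_def blinfun.bilinear_simps AB ST assms(2,3) 0 algebra_simps)
    then show "G c s (G c s x) = G c s x"
      unfolding that by (simp add: G_def blinfun.bilinear_simps)
  qed
  define \<gamma> where "\<gamma> = (\<lambda>t. G (cos (pi / 2 * t)) (sin (pi / 2 * t)))"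
  have "path \<gamma>"
    unfolding path_def \<gamma>_def G_def by (intro continuous_intros)
  moreover have "path_image \<gamma> \<subseteq> projectors"
    unfolding path_image_def \<gamma>_def using G sin_cos_squared_add3 by blast
  moreover have "pathstart \<gamma> = A" "pathfinish \<gamma> = B"
    by (auto simp: pathstart_def pathfinish_def \<gamma>_def G_def)
  ultimately show ?thesis unfolding path_component_def by blast
qed

text \<open>
  \<open>R\<close> takes the \<open>C\<close>-component of \<open>P x\<close>. It is bounded although \<open>C\<close> is only an algebraic complement
  of \<open>U\<close> in the range of \<open>P\<close>, by \<open>finite_dim_component_bounded\<close>.
\<close>

lemma finite_dimensional_summand_projector:
  fixes P :: "'a::real_normed_vector \<Rightarrow>\<^sub>L 'a"
  assumes "P \<in> projectors" "subspace U" "closed U" "subspace C" "finite_dimensional C"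
    and "U \<inter> C = {0}" "{u + c | u c. u \<in> U \<and> c \<in> C} = range (blinfun_apply P)"
  obtains R where "R \<in> projectors" "range (blinfun_apply R) = C"
    "P - R \<in> projectors" "range (blinfun_apply (P - R)) = U"
    "\<And>x. R (P x) = R x" "\<And>x. P (R x) = R x"
proof -
  have PP: "P (P x) = P x" for x using assms(1) by (simp add: projectors_apply)
  have "\<exists>c. c \<in> C \<and> P x - c \<in> U" for x
  proof -
    have "P x \<in> {u + c | u c. u \<in> U \<and> c \<in> C}" using assms(7) by blast
    then obtain u c where uc: "u \<in> U" "c \<in> C" "P x = u + c" by blast
    then have "P x - c \<in> U" by simp
    then show ?thesis using uc by blast
  qed
  then obtain r where r: "\<And>x. r x \<in> C" "\<And>x. P x - r x \<in> U" by metis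
  have uniq: "r x = c" if "c \<in> C" "P x - c \<in> U" for x c
  proof -
    have "r x - c \<in> C" using r that assms(4) by (intro subspace_diff)
    moreover have "(P x - c) - (P x - r x) \<in> U"
      by (rule subspace_diff[OF assms(2) that(2) r(2)])
    then have "r x - c \<in> U" by simp
    ultimately have "r x - c \<in> {0}" using assms(6) by blast
    then show ?thesis by simp
  qed
  obtain B where B: "finite B" "span B = C"
    using assms(5) unfolding finite_dimensional_def by blast
  have spU: "span U = U" using assms(2) by simp
  obtain K where K: "\<And>u c. u \<in> U \<Longrightarrow> c \<in> C \<Longrightarrow> norm c \<le> K * norm (u + c)"
    using finite_dim_component_bounded[of B U] B assms(3,6) unfolding spU
    by (auto simp: Int_commute)
  have "bounded_linear r"
  proof (rule bounded_linear_intro)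
    show "r (x + y) = r x + r y" for x y
    proof (rule uniq)
      have "(P x - r x) + (P y - r y) \<in> U" using r assms(2) by (intro subspace_add)
      then show "P (x + y) - (r x + r y) \<in> U" by (simp add: blinfun.add_right algebra_simps)
    qed (use r assms(4) in \<open>auto intro: subspace_add\<close>)
    show "r (a *\<^sub>R x) = a *\<^sub>R r x" for a x
    proof (rule uniq)
      have "a *\<^sub>R (P x - r x) \<in> U" using r assms(2) by (intro subspace_scale)
      then show "P (a *\<^sub>R x) - a *\<^sub>R r x \<in> U" by (simp add: blinfun.scaleR_right algebra_simps)
    qed (use r assms(4) in \<open>auto intro: subspace_scale\<close>)
    show "norm (r x) \<le> norm x * (\<bar>K\<bar> * norm P)" for x
    proof -
      have "norm (r x) \<le> K * norm (P x)" using K[OF r(2) r(1), of x x] by simp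
      also have "\<dots> \<le> \<bar>K\<bar> * (norm P * norm x)"
        by (intro mult_mono norm_blinfun) auto
      finally show ?thesis by (simp add: algebra_simps)
    qed
  qed
  then obtain R where R: "\<And>x. blinfun_apply R x = r x"
    by (metis bounded_linear_Blinfun_apply)
  have fixC: "P c = c \<and> R c = c" if "c \<in> C" for c
  proof -
    have "0 + c \<in> range (blinfun_apply P)"
      using that assms(2) unfolding assms(7)[symmetric] by (blast intro: subspace_0)
    then have "P c = c" using PP by auto
    moreover from this have "r c = c" using that assms(2) by (intro uniq) (auto intro: subspace_0)
    ultimately show ?thesis using R by simp
  qed
  have fixU: "P u = u \<and> R u = 0" if "u \<in> U" for u
  proof -
    have "u + 0 \<in> range (blinfun_apply P)"
      using that assms(4) unfolding assms(7)[symmetric] by (blast intro: subspace_0)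
    then have "P u = u" using PP by auto
    moreover from this have "r u = 0" using that assms(4) by (intro uniq) (auto intro: subspace_0)
    ultimately show ?thesis using R by simp
  qed
  have RP: "R (P x) = R x" for x
    unfolding R by (rule uniq) (simp_all add: PP r)
  have PR: "P (R x) = R x" and RR: "R (R x) = R x" for x
    using fixC r(1) by (simp_all add: R)
  show ?thesis
  proof (rule that[of R])
    show "R \<in> projectors" using RR by (simp add: projectors_apply)
    show "P - R \<in> projectors" by (simp add: projectors_apply blinfun.bilinear_simps PP RR RP PR)
    show "range (blinfun_apply R) = C" using r(1) fixC R by (metis rangeI subsetI subset_antisym image_subset_iff)
    show "range (blinfun_apply (P - R)) = U"
    proof
      show "range (blinfun_apply (P - R)) \<subseteq> U" using r(2) R by (auto simp: blinfun.diff_left)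
      show "U \<subseteq> range (blinfun_apply (P - R))"
      proof
        fix u assume "u \<in> U"
        then have "u = (P - R) u" using fixU by (simp add: blinfun.diff_left)
        then show "u \<in> range (blinfun_apply (P - R))" by (rule range_eqI)
      qed
    qed
  qed (use RP PR in auto)
qed

section \<open>The relative dimension of a finite-rank enlargement\<close>

lemma linear_inj_image_finite_dimensional:
  fixes f :: "'a::real_vector \<Rightarrow> 'b::real_vector"
  assumes "linear f" "subspace C" "finite_dimensional C" "inj_on f C"
  shows "finite_dimensional (f ` C)" "dim (f ` C) = dim C"
proof -
  obtain B0 where B0: "finite B0" "span B0 = C"
    using assms(3) unfolding finite_dimensional_def by blast
  obtain B where B: "B \<subseteq> B0" "independent B" "B0 \<subseteq> span B"
    by (rule maximal_independent_subset)
  have fin: "finite B" using B B0 finite_subset by blast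
  have sp: "span B = C"
    using B B0 by (metis span_mono span_minimal subspace_span subset_antisym)
  have im: "span (f ` B) = f ` C"
    using linear_span_image[OF assms(1)] sp by simp
  then show "finite_dimensional (f ` C)"
    unfolding finite_dimensional_def using fin by blast
  have "independent (f ` B)"
    using linear_independent_injective_image[OF assms(1) B(2)] assms(4) sp by simp
  then have "dim (f ` C) = card (f ` B)"
    by (metis im dim_span dim_eq_card_independent)
  also have "\<dots> = card B"
    using assms(4) B(1) B0 span_superset by (intro card_image inj_on_subset[OF assms(4)]) blast
  also have "\<dots> = dim C"
    by (metis sp dim_span dim_eq_card_independent B(2))
  finally show "dim (f ` C) = dim C" .
qed

lemma has_codim_self_iff:
  fixes V :: "'a::real_vector set"
  assumes V: "subspace V"
  shows "has_codim V V n \<longleftrightarrow> n = 0"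
proof -
  have dim0: "dim {0::'a} = 0"
    using dim_span[of "{} :: 'a set"] dim_eq_card_independent[OF independent_empty] by simp
  show ?thesis
  proof
    assume "has_codim V V n"
    then obtain C where C: "dim C = n" "V \<inter> C = {0}" "{u + c | u c. u \<in> V \<and> c \<in> C} = V"
      unfolding has_codim_def by blast
    have "C \<subseteq> {u + c | u c. u \<in> V \<and> c \<in> C}" using V by (force intro: subspace_0)
    then have "C = {0}" using C by auto
    then show "n = 0" using C(1) dim0 by simp
  next
    assume "n = 0"
    then show "has_codim V V n"
      unfolding has_codim_def finite_dimensional_def using V dim0
      by (intro exI[of _ "{0}"]) (auto intro: subspace_0 exI[of _ "{}"])
  qed
qed

text \<open>
  Let \<open>P'\<close> be the chosen projector onto the range of \<open>P\<close>, which may have a kernel different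
  from that of \<open>P\<close>. It fixes the range of \<open>P\<close> pointwise, so its restriction to the larger range is
  surjective. A vector \<open>P x + R x\<close> is killed by \<open>P'\<close> exactly if \<open>P x = - P' (R x)\<close>. So the kernel of the
  restriction is the image of the range of \<open>R\<close> under \<open>I - P'\<close>, which is injective there because
  \<open>R (I - P') = R\<close>.
\<close>

lemma relative_dim_add_finite_rank:
  fixes P R :: "'a::real_normed_vector \<Rightarrow>\<^sub>L 'a"
  assumes "P \<in> projectors" "R \<in> projectors" "\<And>x. P (R x) = 0" "\<And>x. R (P x) = 0"
    and "finite_dimensional (range (blinfun_apply R))"
  shows "relative_dim (range (blinfun_apply (P + R))) (range (blinfun_apply P)) =
           int (dim (range (blinfun_apply R)))"
proof -
  let ?V = "range (blinfun_apply (P + R))" and ?W = "range (blinfun_apply P)"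
    and ?F = "range (blinfun_apply R)"
  have PP: "P (P x) = P x" and RR: "R (R x) = R x" for x
    using assms(1,2) by (auto simp: projectors_apply)
  obtain B where B: "finite B" "span B = ?F"
    using assms(5) unfolding finite_dimensional_def by blast
  have PW: "projector_onto P ?W" using assms(1) by (simp add: projector_onto_def)
  have PV: "projector_onto (P + R) ?V"
    by (simp add: projector_onto_def projectors_apply blinfun.bilinear_simps PP RR assms(3,4))
  have "(id_blinfun - (P + R)) o\<^sub>L P = 0"
    by (rule blinfun_eqI) (simp add: blinfun.bilinear_simps PP assms(4))
  moreover have "compact_operator (0 :: 'a \<Rightarrow>\<^sub>L 'a)"
    by (rule finite_rank_compact[of "{}"]) auto
  moreover have "(id_blinfun - P) o\<^sub>L (P + R) = R"
    by (rule blinfun_eqI) (simp add: blinfun.bilinear_simps PP assms(3))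
  moreover have "compact_operator R"
    by (rule finite_rank_compact[of B]) (use B in auto)
  ultimately have cp: "compact_perturbation ?V ?W"
    unfolding compact_perturbation_def using PV PW by metis
  define P' where "P' = (SOME PW. projector_onto PW ?W)"
  have P': "projector_onto P' ?W"
    unfolding P'_def using PW by (rule someI)
  have P'P: "P' (P x) = P x" for x
    using P' unfolding projector_onto_def projectors_apply by (metis rangeE rangeI)
  have PP': "P (P' x) = P' x" for x
    using P' PP unfolding projector_onto_def by (metis rangeE rangeI)
  have subW: "subspace ?W"
    using subspace_UNIV by (intro linear_subspace_image bounded_linear.linear blinfun.bounded_linear_right)
  have img: "blinfun_apply P' ` ?V = ?W"
  proof
    show "blinfun_apply P' ` ?V \<subseteq> ?W" using P' unfolding projector_onto_def by blast
    show "?W \<subseteq> blinfun_apply P' ` ?V"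
    proof
      fix w assume "w \<in> ?W"
      then obtain x where "w = P x" by blast
      then have "w = P' ((P + R) (P x))" by (simp add: blinfun.bilinear_simps PP assms(4) P'P)
      then show "w \<in> blinfun_apply P' ` ?V" by blast
    qed
  qed
  have ker: "{v \<in> ?V. P' v = 0} = blinfun_apply (id_blinfun - P') ` ?F"
  proof (intro subset_antisym subsetI)
    fix v assume v: "v \<in> {v \<in> ?V. P' v = 0}"
    then obtain x where x: "v = P x + R x" by (auto simp: blinfun.add_left)
    then have "P x + P' (R x) = 0" using v by (simp add: blinfun.add_right P'P)
    then have "v = (id_blinfun - P') (R x)"
      unfolding x by (simp add: blinfun.diff_left add_eq_0_iff)
    then show "v \<in> blinfun_apply (id_blinfun - P') ` ?F" by blast
  next
    fix v assume "v \<in> blinfun_apply (id_blinfun - P') ` ?F"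
    then obtain x where x: "v = R x - P' (R x)" by (auto simp: blinfun.diff_left)
    have "R (P' y) = 0" for y by (metis PP' assms(4))
    then have "v = (P + R) v"
      unfolding x by (simp add: blinfun.bilinear_simps PP' RR assms(3))
    moreover have "P' v = 0"
      unfolding x by (metis P'P PP' blinfun.diff_right cancel_comm_monoid_add_class.diff_cancel)
    ultimately show "v \<in> {v \<in> ?V. P' v = 0}" by blast
  qed
  have inj: "inj_on (blinfun_apply (id_blinfun - P')) ?F"
  proof (rule inj_onI)
    fix u v assume uv: "u \<in> ?F" "v \<in> ?F" "(id_blinfun - P') u = (id_blinfun - P') v"
    have Ru: "R u = u" "R v = v" using uv RR by auto
    have "R ((id_blinfun - P') x) = R x" for x
      by (simp add: blinfun.bilinear_simps) (metis PP' assms(4))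
    then show "u = v" using uv(3) Ru by metis
  qed
  have subF: "subspace ?F"
    using subspace_UNIV by (intro linear_subspace_image bounded_linear.linear blinfun.bounded_linear_right)
  note lin = linear_inj_image_finite_dimensional[OF
      bounded_linear.linear[OF blinfun.bounded_linear_right] subF assms(5) inj]
  \<comment> \<open>The range of a projector is its set of fixed points.\<close>
  have closedW: "closed ?W"
  proof -
    have "?W = {x. P x - x = 0}" using PP by (auto intro: range_eqI[OF sym])
    then show ?thesis by (auto intro!: closed_Collect_eq continuous_intros)
  qed
  have codimW: "has_codim ?W ?W = (\<lambda>n. n = 0)"
    using has_codim_self_iff[OF subW] by blast
  moreover have "fredholm_between P' ?V ?W"
    unfolding fredholm_between_def ker img codimW using lin closedW by blast
  ultimately show ?thesis
    using cp
    unfolding relative_dim_def fredholm_index_def P'_def[symmetric] ker img lin by simp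
qed

section \<open>The path to a projector of relative dimension \<open>m\<close>\<close>

theorem proposition8p4:
  fixes X Y :: "'a::banach set"
    and P :: "'a \<Rightarrow>\<^sub>L 'a"
    and m :: nat
  assumes "m \<ge> 1"
    and "subspace X" and "closed X"
    and "subspace Y" and "closed Y"
    and "X \<inter> Y = {0}" and "{x + y | x y. x \<in> X \<and> y \<in> Y} = UNIV"
    and "isomorphic_subspaces X Y"
    and "\<exists>X'. subspace X' \<and> closed X' \<and> has_codim X' X m"
    and "\<forall>X'. subspace X' \<and> closed X' \<and> has_codim X' X m \<longrightarrow> isomorphic_subspaces X X'"
    and "P \<in> projectors" and "range (blinfun_apply P) = X"
    and "{v. blinfun_apply P v = 0} = Y"
  shows "\<exists>Q \<in> projectors. path_component projectors P Q \<and>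
           compact_operator (Q - P) \<and>
           relative_dim (range (blinfun_apply Q)) (range (blinfun_apply P)) = int m"
proof -
  have PP: "P (P x) = P x" for x using assms(11) by (simp add: projectors_apply)
  obtain X' where X': "subspace X'" "closed X'" "has_codim X' X m" "isomorphic_subspaces X X'"
    using assms(9,10) by blast
  obtain C where C: "subspace C" "finite_dimensional C" "dim C = m"
      "X' \<inter> C = {0}" "{u + c | u c. u \<in> X' \<and> c \<in> C} = X"
    using X'(3) unfolding has_codim_def by blast
  have X'C: "{u + c | u c. u \<in> X' \<and> c \<in> C} = range (blinfun_apply P)"
    using C(5) assms(12) by simp
  obtain R0 where R0: "R0 \<in> projectors" "range (blinfun_apply R0) = C"
    "P - R0 \<in> projectors" "range (blinfun_apply (P - R0)) = X'"
    and R0P: "\<And>x. R0 (P x) = R0 x" and PR0: "\<And>x. P (R0 x) = R0 x"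
    by (rule finite_dimensional_summand_projector[OF assms(11) X'(1,2) C(1,2,4) X'C]) (rule that)
  have R0R0: "R0 (R0 x) = R0 x" for x using R0(1) by (simp add: projectors_apply)
  define P1 where "P1 = P - R0"
  have P_P1: "projector_equiv P P1"
    unfolding P1_def using X'(4) R0 assms(11,12)
    by (intro isomorphic_ranges_imp_projector_equiv) auto

  define P\<^sub>Y where "P\<^sub>Y = id_blinfun - P"
  have "range (blinfun_apply P\<^sub>Y) = {v. P v = 0}"
  proof (intro subset_antisym subsetI)
    fix v assume "v \<in> {v. P v = 0}"
    then have "v = P\<^sub>Y v" by (simp add: P\<^sub>Y_def blinfun.diff_left)
    then show "v \<in> range (blinfun_apply P\<^sub>Y)" by (rule range_eqI)
  qed (auto simp: P\<^sub>Y_def blinfun.bilinear_simps PP)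
  then have "projector_equiv P P\<^sub>Y"
    using assms(8,11-13)
    by (intro isomorphic_ranges_imp_projector_equiv)
       (auto simp: projectors_apply P\<^sub>Y_def blinfun.bilinear_simps)
  then obtain S T :: "'a \<Rightarrow>\<^sub>L 'a"
    where ST: "\<And>x. T (S x) = P x" "\<And>x. S (T x) = P\<^sub>Y x" "\<And>x. S (P x) = S x"
      "\<And>x. P\<^sub>Y (S x) = S x" "\<And>x. T (P\<^sub>Y x) = T x" "\<And>x. P (T x) = T x"
    unfolding projector_equiv_def by blast
  have PS: "P (S x) = 0" for x
    using ST(4)[of x] by (simp add: P\<^sub>Y_def blinfun.diff_left)
  have TP: "T (P x) = 0" for x
    using ST(5)[of x] by (simp add: P\<^sub>Y_def blinfun.bilinear_simps)

  define R where "R = S o\<^sub>L R0 o\<^sub>L T"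
  define D where "D = S o\<^sub>L P1 o\<^sub>L T"
  define Q where "Q = P + R"
  \<comment> \<open>The ranges of \<open>R\<close> and \<open>D\<close> are \<open>F = S C\<close> and \<open>Y' = S X'\<close>.\<close>
  have D: "D = id_blinfun - Q"
    by (rule blinfun_eqI)
       (simp add: D_def Q_def R_def P1_def blinfun.bilinear_simps ST P\<^sub>Y_def)
  have RR: "R (R x) = R x" and PR: "P (R x) = 0" and RP: "R (P x) = 0" for x
    by (simp_all add: R_def ST PR0 R0P R0R0 PS TP)
  have R: "R \<in> projectors" using RR by (simp add: projectors_apply)
  have QQ: "Q (Q x) = Q x" for x
    by (simp add: Q_def blinfun.bilinear_simps PP RR PR RP)

  have P1_D: "projector_equiv P1 D"
    unfolding D_def by (rule projector_equiv_transport[of T S P])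
      (simp_all add: ST P1_def blinfun.bilinear_simps PP R0R0 R0P PR0)
  have "projector_equiv R0 R"
    unfolding R_def by (rule projector_equiv_transport[of T S P])
      (simp_all add: ST R0R0 R0P PR0)
  \<comment> \<open>\<open>X\<close> is carried to \<open>X'\<close>, and \<open>F\<close> to the missing summand \<open>C\<close> of \<open>X\<close>.\<close>
  then have "projector_equiv (P + R) (P1 + R0)"
    using P_P1 by (intro projector_equiv_add projector_equiv_sym[of R0])
      (simp_all add: PR RP P1_def blinfun.bilinear_simps PR0 R0P R0R0)
  then have "projector_equiv Q P" by (simp add: Q_def P1_def)
  then have D_Q: "projector_equiv D Q" and P_D: "projector_equiv P D"
    using P_P1 P1_D by (blast intro: projector_equiv_trans projector_equiv_sym)+
  have "path_component projectors P D"
    using P_D by (rule orthogonal_projector_equiv_path_component)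
      (simp_all add: D Q_def blinfun.bilinear_simps PP PR RP)
  moreover have "path_component projectors D Q"
    using D_Q by (rule orthogonal_projector_equiv_path_component)
      (simp_all add: D blinfun.bilinear_simps QQ)
  ultimately have path: "path_component projectors P Q"
    by (rule path_component_trans)

  have "range (blinfun_apply R) = blinfun_apply S ` C"
  proof (intro subset_antisym subsetI)
    fix v assume "v \<in> blinfun_apply S ` C"
    then obtain x where "v = S (R0 x)" using R0(2) by blast
    then have "v = R (S (R0 x))" by (simp add: R_def ST PR0 R0R0)
    then show "v \<in> range (blinfun_apply R)" by (rule range_eqI)
  qed (use R0(2) in \<open>auto simp: R_def\<close>)
  moreover have "inj_on (blinfun_apply S) C"
    using ST(1) PR0 R0(2) by (metis inj_on_inverseI rangeE)
  ultimately have F: "finite_dimensional (range (blinfun_apply R))" "dim (range (blinfun_apply R)) = m"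
    using linear_inj_image_finite_dimensional[OF
        bounded_linear.linear[OF blinfun.bounded_linear_right] C(1,2)] C(3)
    by simp_all

  have "compact_operator R"
    using F(1) unfolding finite_dimensional_def by (metis finite_rank_compact subset_refl)
  then have "compact_operator (Q - P)" by (simp add: Q_def)
  moreover have "Q \<in> projectors" using QQ by (simp add: projectors_apply)
  moreover have "relative_dim (range (blinfun_apply Q)) (range (blinfun_apply P)) = int m"
    unfolding Q_def using relative_dim_add_finite_rank[OF assms(11) R PR RP F(1)] F(2) by simp
  ultimately show ?thesis using path by blast
qed

end
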